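(* For every instance $(F,C,\{f_i\}_{i\in F},d,\{p_j\}_{j\in C})$ of Facility Location with Penalties, the solution $(C',F')$ returned by the algorithm PenaltyFacLoc (described in the context) satisfies $$\mathrm{cost}(C',F')\le 3\cdot \mathrm{cost}(C^*,F^* ),$$ where $(C^*,F^* )$ is an optimal solution of the instance.
   Context: Facility Location with Penalties: the input is a finite set $F$ of facilities with opening costs $f_i\ge 0$, a finite set $C$ of clients with penalties $p_j\ge 0$, and a metric $d$ on $F\cup C$; write $c_{ij}=d(i,j)$. A solution is a pair $(C',F')$ with $C'\subseteq C$, $F'\subseteq F$, and its cost is $\mathrm{cost}(C',F')=\sum_{i\in F'}f_i+\sum_{j\in C'}d(j,F')+\sum_{j\in C\setminus C'}p_j$, where $d(j,F')=\min_{i\in F'}d(i,j)$ (with $d(j,\emptyset)=+\infty$). An optimal solution minimizes the cost. Algorithm PenaltyFacLoc. 1. (Radius computation) For each $i\in F$ compute $r_i\ge 0$ with $f_i=\sum_{j\in C}\max\{\min\{r_i-c_{ij},\,p_j-c_{ij}\},0\}$. Facilities for which no such $r_i$ exists are removed from consideration. 2. (Greedy phase) Number the remaining facilities $1,2,\dots$ in non-decreasing order of $r_i$. Start with $F'=\emptyset$. For $i=1,2,\dots$: if no facility in the current $F'$ is within distance $2r_i$ of $i$, add $i$ to $F'$. 3. (Outlier determination) For each client $j$, put $j$ in $C'$ if $d(j,F')\le p_j$; otherwise $j$ is an outlier. Return $(C',F')$. *)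

theory Defs
  imports "HOL-Analysis.Analysis"
begin

text \<open>
  Facilities and clients are finite sets of points of a common type. They may overlap, so a
  facility and a client can share a location. Opening costs are \<open>f\<close>, penalties are \<open>p\<close>.
\<close>

definition flp_instance ::
  "'a set \<Rightarrow> 'a set \<Rightarrow> ('a \<Rightarrow> real) \<Rightarrow> ('a \<Rightarrow> 'a \<Rightarrow> real) \<Rightarrow> ('a \<Rightarrow> real) \<Rightarrow> bool" where
  "flp_instance F C f d p \<longleftrightarrow>
     finite F \<and> finite C \<and> Metric_space (F \<union> C) d \<and>
     (\<forall>i\<in>F. 0 \<le> f i) \<and> (\<forall>j\<in>C. 0 \<le> p j)"

text \<open>The value is \<open>\<infinity>\<close> when \<open>F' = {}\<close>; for finite nonempty \<open>F'\<close> the infimum is a minimum.\<close>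

definition dist_to_set :: "('a \<Rightarrow> 'a \<Rightarrow> real) \<Rightarrow> 'a \<Rightarrow> 'a set \<Rightarrow> ereal" where
  "dist_to_set d j F' = (INF i\<in>F'. ereal (d i j))"

definition flp_solution :: "'a set \<Rightarrow> 'a set \<Rightarrow> 'a set \<times> 'a set \<Rightarrow> bool" where
  "flp_solution F C = (\<lambda>(C', F'). C' \<subseteq> C \<and> F' \<subseteq> F)"

definition flp_cost ::
  "'a set \<Rightarrow> ('a \<Rightarrow> real) \<Rightarrow> ('a \<Rightarrow> 'a \<Rightarrow> real) \<Rightarrow> ('a \<Rightarrow> real) \<Rightarrow> 'a set \<times> 'a set \<Rightarrow> ereal" where
  "flp_cost C f d p = (\<lambda>(C', F').
     (\<Sum>i\<in>F'. ereal (f i)) + (\<Sum>j\<in>C'. dist_to_set d j F') + (\<Sum>j\<in>C - C'. ereal (p j)))"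

definition flp_optimal ::
  "'a set \<Rightarrow> 'a set \<Rightarrow> ('a \<Rightarrow> real) \<Rightarrow> ('a \<Rightarrow> 'a \<Rightarrow> real) \<Rightarrow> ('a \<Rightarrow> real) \<Rightarrow> 'a set \<times> 'a set \<Rightarrow> bool" where
  "flp_optimal F C f d p S \<longleftrightarrow>
     flp_solution F C S \<and> (\<forall>T. flp_solution F C T \<longrightarrow> flp_cost C f d p S \<le> flp_cost C f d p T)"

definition is_radius ::
  "'a set \<Rightarrow> ('a \<Rightarrow> real) \<Rightarrow> ('a \<Rightarrow> 'a \<Rightarrow> real) \<Rightarrow> ('a \<Rightarrow> real) \<Rightarrow> 'a \<Rightarrow> real \<Rightarrow> bool" where
  "is_radius C f d p i \<rho> \<longleftrightarrow>
     0 \<le> \<rho> \<and> f i = (\<Sum>j\<in>C. max (min (\<rho> - d i j) (p j - d i j)) 0)"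

definition remaining_facilities ::
  "'a set \<Rightarrow> 'a set \<Rightarrow> ('a \<Rightarrow> real) \<Rightarrow> ('a \<Rightarrow> 'a \<Rightarrow> real) \<Rightarrow> ('a \<Rightarrow> real) \<Rightarrow> 'a set" where
  "remaining_facilities F C f d p = {i \<in> F. \<exists>\<rho>. is_radius C f d p i \<rho>}"

definition greedy_open :: "('a \<Rightarrow> 'a \<Rightarrow> real) \<Rightarrow> ('a \<Rightarrow> real) \<Rightarrow> 'a list \<Rightarrow> 'a set" where
  "greedy_open d r is =
     fold (\<lambda>i F'. if \<exists>k\<in>F'. d k i \<le> 2 * r i then F' else insert i F') is {}"

definition served_clients ::
  "'a set \<Rightarrow> ('a \<Rightarrow> 'a \<Rightarrow> real) \<Rightarrow> ('a \<Rightarrow> real) \<Rightarrow> 'a set \<Rightarrow> 'a set" where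
  "served_clients C d p F' = {j \<in> C. dist_to_set d j F' \<le> ereal (p j)}"

text \<open>
  A radius need not be unique (for instance when \<open>f i = 0\<close>), and neither is the order of
  facilities with equal radii. The algorithm is therefore a relation between instances and
  outputs: every choice of radii \<open>r\<close> and of a non-decreasing enumeration \<open>is\<close> is a run.
\<close>

definition penalty_fac_loc_returns ::
  "'a set \<Rightarrow> 'a set \<Rightarrow> ('a \<Rightarrow> real) \<Rightarrow> ('a \<Rightarrow> 'a \<Rightarrow> real) \<Rightarrow> ('a \<Rightarrow> real) \<Rightarrow> 'a set \<times> 'a set \<Rightarrow> bool" where
  "penalty_fac_loc_returns F C f d p S \<longleftrightarrow>
     (\<exists>r is.
        (\<forall>i\<in>remaining_facilities F C f d p. is_radius C f d p i (r i)) \<and>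
        distinct is \<and> set is = remaining_facilities F C f d p \<and> sorted (map r is) \<and>
        S = (served_clients C d p (greedy_open d r is), greedy_open d r is))"

text \<open>Every instance has a run of the algorithm and an optimal solution.\<close>

lemma penalty_fac_loc_returns_exists:
  assumes "flp_instance F C f d p"
  shows "\<exists>S. penalty_fac_loc_returns F C f d p S"
proof -
  let ?R = "remaining_facilities F C f d p"
  have "finite ?R"
    using assms by (simp add: flp_instance_def remaining_facilities_def)
  then obtain xs where xs: "set xs = ?R" "distinct xs"
    using finite_distinct_list by blast
  define r where "r = (\<lambda>i. SOME \<rho>. is_radius C f d p i \<rho>)"
  have "\<forall>i\<in>?R. is_radius C f d p i (r i)"
    unfolding r_def remaining_facilities_def by (auto intro: someI_ex)
  moreover have "distinct (sort_key r xs)" "set (sort_key r xs) = ?R" "sorted (map r (sort_key r xs))"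
    using xs by simp_all
  ultimately show ?thesis
    unfolding penalty_fac_loc_returns_def by blast
qed

lemma flp_optimal_exists:
  assumes "flp_instance F C f d p"
  shows "\<exists>S. flp_optimal F C f d p S"
proof -
  have sols: "flp_solution F C S \<longleftrightarrow> S \<in> Pow C \<times> Pow F" for S
    by (cases S) (simp add: flp_solution_def)
  have fin: "finite (Pow C \<times> Pow F)"
    using assms by (simp add: flp_instance_def)
  have "Pow C \<times> Pow F \<noteq> {}"
    by (simp add: Times_empty Pow_not_empty)
  with fin have "\<exists>S. is_arg_min (flp_cost C f d p) (\<lambda>S. S \<in> Pow C \<times> Pow F) S"
    by (rule ex_is_arg_min_if_finite)
  then show ?thesis
    by (simp only: is_arg_min_linorder flp_optimal_def sols)
qed

end

theory Submission
  imports Defs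
begin

text \<open>
  Let \<open>s j\<close> be what client \<open>j\<close> pays in the output (connection cost or penalty). The opening cost
  of an open facility \<open>i\<close> is split among the clients by the equation defining \<open>r i\<close>; since any two
  open facilities \<open>i\<close>, \<open>k\<close> are more than \<open>2 * max (r i) (r k)\<close> apart, each client contributes to at
  most one of them, and the total \<open>T j\<close> that \<open>j\<close> pays is at most \<open>p j\<close>.

  The opening cost of an arbitrary facility \<open>o\<close> covers, over all clients, the contributions
  \<open>h o j = max (min (r o) (p j) - d o j) 0\<close>; if \<open>o\<close> was removed for lack of a radius, then by the
  intermediate value theorem it even covers \<open>max (p j - d o j) 0\<close>. The triangle
  inequality through the open facility that blocked \<open>o\<close> gives \<open>T j \<le> 3 * (d o j + h o j)\<close>. Applying
  this to the facility that serves \<open>j\<close> in the other solution and summing over \<open>j\<close> gives the factor 3.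
\<close>

section \<open>Cost of a solution\<close>

lemma dist_to_set_attained:
  assumes "finite A" "A \<noteq> {}"
  obtains k where "k \<in> A" "dist_to_set d j A = ereal (d k j)"
proof -
  have "dist_to_set d j A = Min ((\<lambda>i. ereal (d i j)) ` A)"
    unfolding dist_to_set_def using assms by (simp add: Min_Inf)
  moreover have "Min ((\<lambda>i. ereal (d i j)) ` A) \<in> (\<lambda>i. ereal (d i j)) ` A"
    using assms by (intro Min_in) auto
  ultimately show ?thesis using that by auto
qed

lemma dist_to_set_le: "i \<in> A \<Longrightarrow> dist_to_set d j A \<le> ereal (d i j)"
  unfolding dist_to_set_def by (rule INF_lower)

text \<open>Serving a client exactly when its distance is at most its penalty makes it pay the
  smaller of the two. The penalty keeps this amount finite even for empty \<open>A\<close>, so the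
  cost is a real number.\<close>

lemma flp_cost_served_clients:
  assumes "finite A" "finite C"
  obtains s where
    "flp_cost C f d p (served_clients C d p A, A) = ereal ((\<Sum>i\<in>A. f i) + (\<Sum>j\<in>C. s j))"
    "\<And>j. s j \<le> p j" "\<And>i j. i \<in> A \<Longrightarrow> s j \<le> d i j"
proof
  let ?C' = "served_clients C d p A"
  define s where "s j = real_of_ereal (min (dist_to_set d j A) (ereal (p j)))" for j
  have s: "ereal (s j) = min (dist_to_set d j A) (ereal (p j))" for j
  proof (cases "A = {}")
    case True
    then show ?thesis by (simp add: s_def dist_to_set_def top_ereal_def)
  next
    case False
    then obtain k where "dist_to_set d j A = ereal (d k j)"
      using dist_to_set_attained assms(1) by metis
    then show ?thesis by (simp add: s_def min_def)
  qed
  show "s j \<le> p j" for j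
    using s[of j] by (metis ereal_less_eq(3) min.cobounded2)
  show "s j \<le> d i j" if "i \<in> A" for i j
    using s[of j] dist_to_set_le[OF that, of d j] by (metis ereal_less_eq(3) min.coboundedI1)
  have sub: "?C' \<subseteq> C" by (auto simp: served_clients_def)
  have "(\<Sum>j\<in>?C'. dist_to_set d j A) = (\<Sum>j\<in>?C'. ereal (s j))"
    by (intro sum.cong) (auto simp: s served_clients_def min_def)
  moreover have "(\<Sum>j\<in>C - ?C'. ereal (p j)) = (\<Sum>j\<in>C - ?C'. ereal (s j))"
    by (intro sum.cong) (auto simp: s served_clients_def min_def)
  moreover have "(\<Sum>j\<in>?C'. s j) + (\<Sum>j\<in>C - ?C'. s j) = (\<Sum>j\<in>C. s j)"
    using sum.subset_diff[OF sub assms(2), of s] by simp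
  ultimately show "flp_cost C f d p (?C', A) = ereal ((\<Sum>i\<in>A. f i) + (\<Sum>j\<in>C. s j))"
    by (simp add: flp_cost_def add.assoc)
qed

lemma flp_cost_assignment:
  assumes "finite A" "A \<noteq> {} \<or> B = {}"
  obtains \<phi> where
    "\<And>j. j \<in> B \<Longrightarrow> \<phi> j \<in> A"
    "flp_cost C f d p (B, A) = ereal ((\<Sum>i\<in>A. f i) + (\<Sum>j\<in>B. d (\<phi> j) j) + (\<Sum>j\<in>C - B. p j))"
proof -
  have "\<forall>j\<in>B. \<exists>k\<in>A. dist_to_set d j A = ereal (d k j)"
    using dist_to_set_attained[OF assms(1)] assms(2) by (metis empty_iff)
  then obtain \<phi> where \<phi>: "\<forall>j\<in>B. \<phi> j \<in> A \<and> dist_to_set d j A = ereal (d (\<phi> j) j)"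
    by metis
  have "(\<Sum>j\<in>B. dist_to_set d j A) = (\<Sum>j\<in>B. ereal (d (\<phi> j) j))"
    using \<phi> by (intro sum.cong) auto
  then have "flp_cost C f d p (B, A)
      = ereal ((\<Sum>i\<in>A. f i) + (\<Sum>j\<in>B. d (\<phi> j) j) + (\<Sum>j\<in>C - B. p j))"
    by (simp add: flp_cost_def)
  with \<phi> that show ?thesis by blast
qed

lemma flp_cost_no_facility:
  assumes "finite B" "B \<noteq> {}"
  shows "flp_cost C f d p (B, {}) = \<infinity>"
proof -
  have "(\<Sum>j\<in>B. dist_to_set d j {}) = \<infinity>"
    using assms by (auto simp: sum_Pinfty dist_to_set_def top_ereal_def)
  then show ?thesis by (simp add: flp_cost_def)
qed

section \<open>The greedy phase\<close>

lemma greedy_open_snoc: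
  "greedy_open d r (xs @ [x]) =
     (if \<exists>k\<in>greedy_open d r xs. d k x \<le> 2 * r x then greedy_open d r xs
      else insert x (greedy_open d r xs))"
  by (simp add: greedy_open_def)

lemma greedy_open_subset: "greedy_open d r xs \<subseteq> set xs"
  by (induction xs rule: rev_induct) (auto simp: greedy_open_snoc, simp add: greedy_open_def)

text \<open>A facility that is not opened is blocked by one processed earlier, whose radius is no
  larger by sortedness; an opened facility is its own witness \<open>k\<close>.\<close>

lemma greedy_open_covers:
  assumes "sorted (map r xs)" "\<And>x. x \<in> set xs \<Longrightarrow> d x x = 0 \<and> 0 \<le> r x" "i \<in> set xs"
  shows "\<exists>k\<in>greedy_open d r xs. d k i \<le> 2 * r i \<and> r k \<le> r i"
  using assms
proof (induction xs rule: rev_induct)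
  case (snoc x xs)
  have le: "r k \<le> r x" if "k \<in> greedy_open d r xs" for k
    using that snoc.prems(1) greedy_open_subset[of d r xs] by (auto simp: sorted_append)
  show ?case
  proof (cases "i \<in> set xs")
    case True
    then have "\<exists>k\<in>greedy_open d r xs. d k i \<le> 2 * r i \<and> r k \<le> r i"
      using snoc by (auto simp: sorted_append)
    then show ?thesis by (auto simp: greedy_open_snoc)
  next
    case False
    then have "i = x" using snoc.prems(3) by simp
    then show ?thesis
      using snoc.prems(2)[of x] le by (auto simp: greedy_open_snoc)
  qed
qed simp

text \<open>The later of two open facilities was tested against the earlier one and has a radius at
  least as large; with symmetry of \<open>d\<close> the strict bound follows for both radii.\<close>

lemma greedy_open_separated:
  assumes "sorted (map r xs)" "\<And>x y. x \<in> set xs \<Longrightarrow> y \<in> set xs \<Longrightarrow> d x y = d y x"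
    and "i \<in> greedy_open d r xs" "k \<in> greedy_open d r xs" "i \<noteq> k"
  shows "2 * r i < d i k"
  using assms
proof (induction xs arbitrary: i k rule: rev_induct)
  case Nil
  then show ?case by (simp add: greedy_open_def)
next
  case (snoc x xs)
  note sub = greedy_open_subset[of d r xs]
  have IH: "2 * r i < d i k"
    if "i \<in> greedy_open d r xs" "k \<in> greedy_open d r xs" "i \<noteq> k" for i k
    using that snoc.prems(1,2) by (intro snoc.IH) (auto simp: sorted_append)
  have le: "r k \<le> r x" if "k \<in> greedy_open d r xs" for k
    using that snoc.prems(1) sub by (auto simp: sorted_append)
  show ?case
  proof (cases "\<exists>k\<in>greedy_open d r xs. d k x \<le> 2 * r x")
    case True
    then show ?thesis using IH snoc.prems(3-5) by (simp add: greedy_open_snoc)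
  next
    case False
    have far: "2 * r k < d k x" "2 * r x < d x k" if k: "k \<in> greedy_open d r xs" for k
    proof -
      have "2 * r x < d k x" using False k by auto
      moreover have "d x k = d k x" using k sub by (intro snoc.prems(2)) auto
      ultimately show "2 * r k < d k x" "2 * r x < d x k" using le[OF k] by auto
    qed
    have "greedy_open d r (xs @ [x]) = insert x (greedy_open d r xs)"
      using False by (simp only: greedy_open_snoc if_False)
    then show ?thesis
      using far IH snoc.prems(3-5) by auto
  qed
qed

section \<open>Facilities without a radius\<close>

text \<open>Otherwise the total contribution, continuous in the radius and 0 at radius 0, would
  reach \<open>f i\<close> at some radius.\<close>

lemma no_radius_opening_cost:
  assumes "finite C" "0 \<le> f i" "\<And>j. j \<in> C \<Longrightarrow> 0 \<le> d i j" "\<nexists>\<rho>. is_radius C f d p i \<rho>"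
  shows "(\<Sum>j\<in>C. max (p j - d i j) 0) \<le> f i"
proof (rule ccontr)
  assume less: "\<not> ?thesis"
  define g where "g \<rho> = (\<Sum>j\<in>C. max (min (\<rho> - d i j) (p j - d i j)) 0)" for \<rho>
  \<comment> \<open>\<open>M\<close> dominates every penalty, so at radius \<open>M\<close> each
    minimum is \<open>p j - d i j\<close>.\<close>
  define M where "M = (\<Sum>j\<in>C. \<bar>p j\<bar>)"
  have "0 \<le> M" unfolding M_def by (simp add: sum_nonneg)
  have "p j \<le> M" if "j \<in> C" for j
    using member_le_sum[OF that, of "\<lambda>j. \<bar>p j\<bar>"] assms(1) unfolding M_def by force
  then have "g M = (\<Sum>j\<in>C. max (p j - d i j) 0)"
    unfolding g_def by (intro sum.cong refl) (simp add: min.absorb2)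
  then have "f i \<le> g M" using less by simp
  moreover have "g 0 = 0"
    unfolding g_def using assms(3) by (intro sum.neutral ballI) force
  moreover have "continuous_on {0..M} g"
    unfolding g_def by (intro continuous_intros)
  ultimately obtain \<rho> where "0 \<le> \<rho>" "g \<rho> = f i"
    using IVT'[of g 0 "f i" M] assms(2) \<open>0 \<le> M\<close> by auto
  then have "is_radius C f d p i \<rho>" by (simp add: is_radius_def g_def)
  with assms(4) show False by blast
qed

section \<open>The charging argument\<close>

text \<open>For a fixed client, \<open>a i\<close> stands for its distance to \<open>i\<close> and
  \<open>\<rho> i\<close> for the radius of \<open>i\<close>. By \<open>unique\<close> at most one
  summand is positive, and adding \<open>s \<le> a i\<close> to it cancels the distance.\<close>

lemma client_total:
  fixes a \<rho> :: "'a \<Rightarrow> real"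
  assumes "finite A" and "s \<le> q" and s: "\<And>i. i \<in> A \<Longrightarrow> s \<le> a i"
    and unique: "\<And>i k. i \<in> A \<Longrightarrow> k \<in> A \<Longrightarrow> a i < \<rho> i \<Longrightarrow> a k < \<rho> k \<Longrightarrow> i = k"
  defines "T \<equiv> s + (\<Sum>i\<in>A. max (min (\<rho> i - a i) (q - a i)) 0)"
  shows "T = s \<or> (\<exists>i\<in>A. a i < \<rho> i \<and> T \<le> min (\<rho> i) q)"
proof (cases "\<exists>i\<in>A. a i < min (\<rho> i) q")
  case True
  then obtain i where i: "i \<in> A" "a i < \<rho> i" "a i < q" by auto
  have "(\<Sum>k\<in>A - {i}. max (min (\<rho> k - a k) (q - a k)) 0) = 0"
  proof (intro sum.neutral ballI)
    fix k assume "k \<in> A - {i}"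
    then have "\<rho> k \<le> a k" using unique[of i k] i by force
    then show "max (min (\<rho> k - a k) (q - a k)) 0 = 0" by simp
  qed
  then have "T = s + max (min (\<rho> i - a i) (q - a i)) 0"
    unfolding T_def by (subst sum.remove[OF assms(1) i(1)]) simp
  then have "T \<le> min (\<rho> i) q" using i s[OF i(1)] by (auto simp: min_def max_def split: if_splits)
  with i show ?thesis by blast
next
  case False
  then have "(\<Sum>k\<in>A. max (min (\<rho> k - a k) (q - a k)) 0) = 0"
    by (intro sum.neutral ballI) (auto simp: not_less)
  then show ?thesis by (simp add: T_def)
qed

lemma client_total_le:
  fixes r p :: "'a \<Rightarrow> real"
  assumes "Metric_space X d" "finite A" "A \<subseteq> X" "j \<in> X"
    and s: "s \<le> p j" "\<And>i. i \<in> A \<Longrightarrow> s \<le> d i j"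
    and sep: "\<And>i k. i \<in> A \<Longrightarrow> k \<in> A \<Longrightarrow> i \<noteq> k \<Longrightarrow> 2 * r i < d i k"
  defines "T \<equiv> s + (\<Sum>i\<in>A. max (min (r i - d i j) (p j - d i j)) 0)"
  shows client_total_le_penalty: "T \<le> p j"
    and client_total_le_contribution:
      "\<lbrakk>z \<in> X; k \<in> A; d k z \<le> 2 * r z; r k \<le> r z\<rbrakk>
        \<Longrightarrow> T \<le> 3 * (d z j + max (min (r z - d z j) (p j - d z j)) 0)"
proof -
  interpret Metric_space X d by fact
  have tri: "d i k \<le> d i j + d k j" if "i \<in> A" "k \<in> A" for i k
    using that assms(3,4) triangle[of i j k] commute[of k j] by auto
  \<comment> \<open>Two balls sharing the client would give \<open>d i k < r i + r k\<close>,
    against \<open>sep\<close> for the larger radius.\<close>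
  have unique: "i = k" if "i \<in> A" "k \<in> A" "d i j < r i" "d k j < r k" for i k
  proof (rule ccontr)
    assume "i \<noteq> k"
    then have "2 * r i < d i k" "2 * r k < d i k"
      using sep[of i k] sep[of k i] commute[of i k] that by auto
    with tri[OF that(1,2)] that(3,4) show False by linarith
  qed
  have T: "T = s \<or> (\<exists>i\<in>A. d i j < r i \<and> T \<le> min (r i) (p j))"
    unfolding T_def using client_total[of A s "p j" "\<lambda>i. d i j" r] assms(2) s unique by blast
  then show le: "T \<le> p j" using s(1) by auto
  assume z: "z \<in> X" and k: "k \<in> A" "d k z \<le> 2 * r z" "r k \<le> r z"
  have kj: "d k j \<le> 2 * r z + d z j"
    using triangle[of k z j] z k assms(3,4) by auto
  have "T \<le> 2 * r z + d z j"
    using T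
  proof
    assume "T = s"
    then show ?thesis using s(2)[OF k(1)] kj by simp
  next
    assume "\<exists>i\<in>A. d i j < r i \<and> T \<le> min (r i) (p j)"
    then obtain i where i: "i \<in> A" "d i j < r i" "T \<le> r i" by auto
    show ?thesis
    proof (cases "i = k")
      case True
      have "0 \<le> d i j" "0 \<le> d z j" "r i \<le> r z" using True k(3) by simp_all
      then show ?thesis using i by linarith
    next
      case False
      \<comment> \<open>Together with \<open>d i j < r i\<close> this yields
        \<open>r i < d k j\<close>, so \<open>T\<close> is below the distance to the blocking
        facility \<open>k\<close>.\<close>
      then have "2 * r i < d i j + d k j" using sep[of i k] tri[of i k] i k by force
      then show ?thesis using i kj by linarith
    qed
  qed
  \<comment> \<open>The bracket equals \<open>max (d z j) (min (r z) (p j))\<close>. If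
    \<open>r z \<le> p j\<close>, three times it is at least \<open>2 * r z + d z j\<close>;
    otherwise \<open>T \<le> p j\<close> suffices.\<close>
  then show "T \<le> 3 * (d z j + max (min (r z - d z j) (p j - d z j)) 0)"
    using le nonneg[of z j] by (smt (verit))
qed

theorem theorem17:
  fixes F C :: "'a set" and f p :: "'a \<Rightarrow> real" and d :: "'a \<Rightarrow> 'a \<Rightarrow> real"
    and C' F' Copt Fopt :: "'a set"
  assumes "flp_instance F C f d p"
    and "penalty_fac_loc_returns F C f d p (C', F')"
    and "flp_optimal F C f d p (Copt, Fopt)"
  shows "flp_cost C f d p (C', F') \<le> 3 * flp_cost C f d p (Copt, Fopt)"
proof (cases "Fopt = {} \<and> Copt \<noteq> {}")
  case True
  have "finite Copt"
    using assms(1,3) by (auto simp: flp_optimal_def flp_solution_def flp_instance_def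
      intro: finite_subset)
  with True show ?thesis by (simp add: flp_cost_no_facility)
next
  case False
  have fin: "finite F" "finite C" and metric: "Metric_space (F \<union> C) d"
    and f0: "\<And>i. i \<in> F \<Longrightarrow> 0 \<le> f i" and p0: "\<And>j. j \<in> C \<Longrightarrow> 0 \<le> p j"
    using assms(1) by (auto simp: flp_instance_def)
  interpret Metric_space "F \<union> C" d by fact
  have opt: "Copt \<subseteq> C" "Fopt \<subseteq> F"
    using assms(3) by (auto simp: flp_optimal_def flp_solution_def)
  have finopt: "finite Fopt" "finite Copt"
    using opt fin by (auto intro: finite_subset)
  let ?R = "remaining_facilities F C f d p"
  have RF: "?R \<subseteq> F" by (auto simp: remaining_facilities_def)
  obtain r xs where rad: "\<And>i. i \<in> ?R \<Longrightarrow> is_radius C f d p i (r i)"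
    and xs: "set xs = ?R" "sorted (map r xs)"
    and F': "F' = greedy_open d r xs" and C': "C' = served_clients C d p F'"
    using assms(2) unfolding penalty_fac_loc_returns_def by blast
  have F'R: "F' \<subseteq> ?R" using greedy_open_subset[of d r xs] F' xs by simp
  then have F'F: "F' \<subseteq> F" using RF by (rule subset_trans)
  then have finF': "finite F'" using fin(1) by (rule finite_subset)
  have covers: "\<exists>k\<in>F'. d k i \<le> 2 * r i \<and> r k \<le> r i" if "i \<in> ?R" for i
    unfolding F'
  proof (rule greedy_open_covers)
    fix x assume "x \<in> set xs"
    then show "d x x = 0 \<and> 0 \<le> r x"
      using xs(1) rad RF by (auto simp: is_radius_def)
  qed (use that xs in auto)
  have sep: "2 * r i < d i k" if "i \<in> F'" "k \<in> F'" "i \<noteq> k" for i k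
    using greedy_open_separated[OF xs(2), of d i k] that commute F' by blast
  obtain s where cost: "flp_cost C f d p (C', F') = ereal ((\<Sum>i\<in>F'. f i) + (\<Sum>j\<in>C. s j))"
    and s: "\<And>j. s j \<le> p j" "\<And>i j. i \<in> F' \<Longrightarrow> s j \<le> d i j"
    using flp_cost_served_clients[OF finF' fin(2), where f = f and d = d and p = p] C' by metis
  obtain \<phi> where \<phi>: "\<And>j. j \<in> Copt \<Longrightarrow> \<phi> j \<in> Fopt"
    and costopt: "flp_cost C f d p (Copt, Fopt)
      = ereal ((\<Sum>i\<in>Fopt. f i) + (\<Sum>j\<in>Copt. d (\<phi> j) j) + (\<Sum>j\<in>C - Copt. p j))"
    using flp_cost_assignment[OF finopt(1), of Copt C f d p] False by blast
  define T where "T j = s j + (\<Sum>i\<in>F'. max (min (r i - d i j) (p j - d i j)) 0)" for j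
  \<comment> \<open>Without a radius the contribution is capped by the penalty alone, so
    \<open>d i j + h i j\<close> is at least \<open>p j\<close>, which bounds
    \<open>T j\<close>.\<close>
  define h where "h i j = (if i \<in> ?R then max (min (r i - d i j) (p j - d i j)) 0
    else max (p j - d i j) 0)" for i j
  have T_p: "T j \<le> p j" if "j \<in> C" for j
    unfolding T_def using client_total_le_penalty[OF metric finF', of j "s j" p r] that s sep F'F
    by blast
  have T_h: "T j \<le> 3 * (d i j + h i j)" if "i \<in> F" "j \<in> C" for i j
  proof (cases "i \<in> ?R")
    case True
    with covers obtain k where "k \<in> F'" "d k i \<le> 2 * r i" "r k \<le> r i" by blast
    then show ?thesis
      unfolding T_def h_def if_P[OF True]
      using client_total_le_contribution[OF metric finF', of j "s j" p r i k] that s sep F'F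
      by blast
  next
    case False
    then show ?thesis
      using T_p[OF that(2)] p0[OF that(2)] nonneg[of i j] by (auto simp: h_def max_def)
  qed
  have h_f: "(\<Sum>j\<in>C. h i j) \<le> f i" if "i \<in> F" for i
  proof (cases "i \<in> ?R")
    case True
    then show ?thesis using rad[OF True] by (simp add: h_def is_radius_def)
  next
    case False
    then have "\<nexists>\<rho>. is_radius C f d p i \<rho>"
      using that by (simp add: remaining_facilities_def)
    then have "(\<Sum>j\<in>C. max (p j - d i j) 0) \<le> f i"
      using fin(2) f0[OF that] by (intro no_radius_opening_cost) auto
    with False show ?thesis by (simp add: h_def)
  qed
  have h0: "0 \<le> h i j" for i j by (simp add: h_def)
  have "(\<Sum>i\<in>F'. f i) = (\<Sum>i\<in>F'. \<Sum>j\<in>C. max (min (r i - d i j) (p j - d i j)) 0)"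
    using rad F'R by (intro sum.cong) (auto simp: is_radius_def)
  also have "\<dots> = (\<Sum>j\<in>C. \<Sum>i\<in>F'. max (min (r i - d i j) (p j - d i j)) 0)"
    by (rule sum.swap)
  finally have "(\<Sum>i\<in>F'. f i) + (\<Sum>j\<in>C. s j) = (\<Sum>j\<in>C. T j)"
    by (simp add: T_def sum.distrib)
  also have "\<dots> = (\<Sum>j\<in>C - Copt. T j) + (\<Sum>j\<in>Copt. T j)"
    by (rule sum.subset_diff[OF opt(1) fin(2)])
  also have "(\<Sum>j\<in>C - Copt. T j) \<le> (\<Sum>j\<in>C - Copt. p j)"
    using T_p by (intro sum_mono) auto
  \<comment> \<open>Outliers are charged without loss; the factor 3 is lost only on clients served
    by \<open>Fopt\<close>.\<close>
  also have "(\<Sum>j\<in>C - Copt. p j) \<le> 3 * (\<Sum>j\<in>C - Copt. p j)"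
    using sum_nonneg[of "C - Copt" p] p0 by simp
  also have "(\<Sum>j\<in>Copt. T j) \<le> (\<Sum>j\<in>Copt. 3 * (d (\<phi> j) j + h (\<phi> j) j))"
    using T_h \<phi> opt by (intro sum_mono) blast
  also have "\<dots> = 3 * ((\<Sum>j\<in>Copt. d (\<phi> j) j) + (\<Sum>j\<in>Copt. h (\<phi> j) j))"
    by (simp flip: sum_distrib_left add: sum.distrib)
  also have "(\<Sum>j\<in>Copt. h (\<phi> j) j) \<le> (\<Sum>i\<in>Fopt. f i)"
  proof -
    \<comment> \<open>Nonnegativity of \<open>h\<close> allows adding all other pairs of a facility
      in \<open>Fopt\<close> and a client; after the swap \<open>h_f\<close> applies to each
      facility.\<close>
    have "(\<Sum>j\<in>Copt. h (\<phi> j) j) \<le> (\<Sum>j\<in>Copt. \<Sum>i\<in>Fopt. h i j)"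
      using \<phi> h0 finopt by (intro sum_mono member_le_sum) auto
    also have "\<dots> \<le> (\<Sum>j\<in>C. \<Sum>i\<in>Fopt. h i j)"
      using opt fin h0 by (intro sum_mono2 sum_nonneg) auto
    also have "\<dots> = (\<Sum>i\<in>Fopt. \<Sum>j\<in>C. h i j)"
      by (rule sum.swap)
    also have "\<dots> \<le> (\<Sum>i\<in>Fopt. f i)"
      using h_f opt by (intro sum_mono) blast
    finally show ?thesis .
  qed
  finally have "(\<Sum>i\<in>F'. f i) + (\<Sum>j\<in>C. s j)
      \<le> 3 * ((\<Sum>i\<in>Fopt. f i) + (\<Sum>j\<in>Copt. d (\<phi> j) j) + (\<Sum>j\<in>C - Copt. p j))"
    by simp
  then show ?thesis unfolding cost costopt by simp
qed

end
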